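(* Let $R>1$, $M=\mathbb{S}^1$ and $N=\mathbb{S}^1_R$, and let $h_R:\mathbb{R}^2\to\mathbb{R}^2$ be the radial map $h_R(p)=Rp$. The restriction of $h_R$ to $\mathbb{S}^1$ minimizes the functional $\Lambda:\operatorname{Diff}^2(M,N)\to\mathbb{R}_+$, $$\Lambda(h)=\int_M\|h^*g_N-g_M\|^2\,\omega_M+\int_M\|h^*\mathrm{II}_N-\mathrm{II}_M\|^2\,\omega_M.$$
   Context: $\mathbb{S}^1$ is the unit circle in $\mathbb{R}^2$ and $\mathbb{S}^1_R$ the concentric circle of radius $R$, both positively oriented, with the metrics $g_M$, $g_N$ inherited from $\mathbb{R}^2$. $\operatorname{Diff}^2(M,N)$ is the set of $C^2$ diffeomorphisms $M\to N$; $\omega_M$ is the volume (length) form of $M$. $\mathrm{II}_S(X,Y)=\langle\bar\nabla_X\mathcal{N},Y\rangle$ is the second fundamental form, with $\bar\nabla$ the flat connection of $\mathbb{R}^2$ and $\mathcal{N}$ the unit normal such that $(X,\mathcal{N})$ is positively oriented for positively oriented tangent $X$. $\|\cdot\|$ is the fiber norm on $(0,2)$-tensors on $M$ induced by $g_M^*\otimes g_M^*$. *)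

theory Defs
  imports "HOL-Analysis.Analysis"
begin

abbreviation circle :: "real \<Rightarrow> (real^2) set" where
  "circle r \<equiv> sphere 0 r"

subsection \<open>Maps of class C2 and diffeomorphisms\<close>

definition C2_on :: "(real^2) set \<Rightarrow> (real^2 \<Rightarrow> real^2) \<Rightarrow> bool" where
  "C2_on U F \<longleftrightarrow>
    (\<exists>(F' :: real^2 \<Rightarrow> (real^2) \<Rightarrow>\<^sub>L (real^2))
      (F'' :: real^2 \<Rightarrow> (real^2) \<Rightarrow>\<^sub>L ((real^2) \<Rightarrow>\<^sub>L (real^2))).
      (\<forall>x\<in>U. (F has_derivative blinfun_apply (F' x)) (at x)) \<and>
      (\<forall>x\<in>U. (F' has_derivative blinfun_apply (F'' x)) (at x)) \<and>
      continuous_on U F'')"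

text \<open>A map defined on a submanifold \<open>S\<close> of the plane is of class C2 if near each point of
  \<open>S\<close> it is the restriction of a C2 map defined on an open subset of the plane.\<close>

definition C2_map :: "(real^2) set \<Rightarrow> (real^2 \<Rightarrow> real^2) \<Rightarrow> bool" where
  "C2_map S f \<longleftrightarrow>
    (\<forall>p\<in>S. \<exists>U F. open U \<and> p \<in> U \<and> C2_on U F \<and> (\<forall>q\<in>U \<inter> S. F q = f q))"

text \<open>Maps from \<open>M\<close> to \<open>N\<close> are extensional functions, so that each diffeomorphism has exactly
  one representative.\<close>

definition Diff2 :: "(real^2) set \<Rightarrow> (real^2) set \<Rightarrow> (real^2 \<Rightarrow> real^2) set" where
  "Diff2 M N =
    {h \<in> M \<rightarrow>\<^sub>E N. bij_betw h M N \<and> C2_map M h \<and> C2_map N (inv_into M h)}"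

subsection \<open>Tangent vectors, orientation and unit normal\<close>

definition tangent_space :: "(real^2) set \<Rightarrow> real^2 \<Rightarrow> (real^2) set" where
  "tangent_space S p =
    {v. \<exists>c. c 0 = p \<and> (\<forall>\<^sub>F t in nhds 0. c t \<in> S) \<and> (c has_vector_derivative v) (at (0::real))}"

text \<open>On a curve \<open>S\<close>, the derivative within \<open>S\<close> is determined by the map only on tangent vectors
  of \<open>S\<close>; it is applied to such vectors only, where it is the intrinsic differential. It depends
  only on the values of \<open>f\<close> on \<open>S\<close>.\<close>

definition differential :: "(real^2) set \<Rightarrow> (real^2 \<Rightarrow> real^2) \<Rightarrow> real^2 \<Rightarrow> real^2 \<Rightarrow> real^2" where
  "differential S f p X = frechet_derivative f (at p within S) X"

definition pos_oriented :: "real^2 \<Rightarrow> real^2 \<Rightarrow> bool" where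
  "pos_oriented X Y \<longleftrightarrow> det (vector [X, Y] :: real^2^2) > 0"

text \<open>Positive orientation of a circle centred at the origin is the counterclockwise one: the
  outward vector \<open>p\<close> followed by the tangent vector is a positively oriented basis.\<close>

definition pos_tangent :: "(real^2) set \<Rightarrow> real^2 \<Rightarrow> real^2 \<Rightarrow> bool" where
  "pos_tangent S p X \<longleftrightarrow> X \<in> tangent_space S p \<and> pos_oriented p X"

definition unit_normal :: "(real^2) set \<Rightarrow> real^2 \<Rightarrow> real^2" where
  "unit_normal S p =
    (THE n. norm n = 1 \<and> (\<forall>X\<in>tangent_space S p. X \<bullet> n = 0) \<and>
            (\<forall>X. pos_tangent S p X \<longrightarrow> pos_oriented X n))"

subsection \<open>Tensors of type (0,2)\<close>

type_synonym tensor02 = "real^2 \<Rightarrow> real^2 \<Rightarrow> real^2 \<Rightarrow> real"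

definition induced_metric :: tensor02 where
  "induced_metric p X Y = X \<bullet> Y"

definition second_form :: "(real^2) set \<Rightarrow> tensor02" where
  "second_form S p X Y = differential S (unit_normal S) p X \<bullet> Y"

definition pullback :: "(real^2) set \<Rightarrow> (real^2 \<Rightarrow> real^2) \<Rightarrow> tensor02 \<Rightarrow> tensor02" where
  "pullback M h B p X Y = B (h p) (differential M h p X) (differential M h p Y)"

definition orthonormal_basis :: "(real^2) set \<Rightarrow> (real^2) set \<Rightarrow> bool" where
  "orthonormal_basis V E \<longleftrightarrow> pairwise orthogonal E \<and> (\<forall>e\<in>E. norm e = 1) \<and> span E = V"

text \<open>The norm induced by the dual metric on the second tensor power of the cotangent space: the
  products of the dual basis of an orthonormal basis of the tangent space are orthonormal.
  The value does not depend on the basis chosen.\<close>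

definition tensor_norm :: "(real^2) set \<Rightarrow> real^2 \<Rightarrow> (real^2 \<Rightarrow> real^2 \<Rightarrow> real) \<Rightarrow> real" where
  "tensor_norm S p B =
    (let E = (SOME E. orthonormal_basis (tangent_space S p) E)
     in sqrt (\<Sum>e\<in>E. \<Sum>f\<in>E. (B e f)\<^sup>2))"

subsection \<open>Integration over a circle\<close>

definition length_form :: "(real^2) set \<Rightarrow> real^2 \<Rightarrow> real^2 \<Rightarrow> real" where
  "length_form S p X = X \<bullet> (THE \<tau>. pos_tangent S p \<tau> \<and> norm \<tau> = 1)"

definition circle_param :: "real \<Rightarrow> real \<Rightarrow> real^2" where
  "circle_param r t = vector [r * cos t, r * sin t]"

text \<open>Integral of a 1-form over the positively oriented circle of radius \<open>r\<close>.\<close>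

definition form_integral :: "real \<Rightarrow> (real^2 \<Rightarrow> real^2 \<Rightarrow> real) \<Rightarrow> real" where
  "form_integral r \<alpha> =
    integral {0..2*pi}
      (\<lambda>t. \<alpha> (circle_param r t) (vector_derivative (circle_param r) (at t)))"

subsection \<open>The functional\<close>

definition Lam :: "real \<Rightarrow> (real^2 \<Rightarrow> real^2) \<Rightarrow> real" where
  "Lam R h =
    (let M = circle 1; N = circle R in
      form_integral 1 (\<lambda>p X.
        (tensor_norm M p (\<lambda>Y Z. pullback M h induced_metric p Y Z - induced_metric p Y Z))\<^sup>2
          * length_form M p X)
    + form_integral 1 (\<lambda>p X.
        (tensor_norm M p (\<lambda>Y Z. pullback M h (second_form N) p Y Z - second_form M p Y Z))\<^sup>2
          * length_form M p X))"

end

theory Submission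
  imports Defs "HOL-Complex_Analysis.Winding_Numbers"
begin

text \<open>
  For unit tangents \<open>\<tau>\<close> of the unit circle put \<open>u = |dh(\<tau>)|\<close>. Both forms are one-dimensional, and
  \<open>II\<^sub>N = - g\<^sub>N / R\<close>, \<open>II\<^sub>M = - g\<^sub>M\<close>, so \<open>\<Lambda>(h)\<close> is the integral of \<open>\<phi>(u)\<close> with
  \<open>\<phi>(u) = (u\<^sup>2 - 1)\<^sup>2 + (u\<^sup>2/R - 1)\<^sup>2\<close>. On \<open>u \<ge> 0\<close> the quartic \<open>\<phi>\<close> lies above its tangent line at
  \<open>u = R\<close>, whose slope \<open>4 (R\<^sup>3 - 1)\<close> is positive, and the integral of \<open>u\<close>, the length of the
  image curve, is at least \<open>2 \<pi> R\<close> because that curve winds once around the origin.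
\<close>

section \<open>Quarter turn and orientation in the plane\<close>

definition rot :: "real^2 \<Rightarrow> real^2" where
  "rot p = vector [- (p $ 2), p $ 1]"

lemma rot_nth [simp]: "rot p $ 1 = - (p $ 2)" "rot p $ 2 = p $ 1"
  by (simp_all add: rot_def)

lemma inner_vec2: "x \<bullet> y = x $ 1 * y $ 1 + x $ 2 * y $ 2" for x y :: "real^2"
  by (simp add: inner_vec_def sum_2)

lemma inner_rot [simp]: "rot p \<bullet> p = 0" "p \<bullet> rot p = 0" "rot p \<bullet> rot q = p \<bullet> q"
  by (simp_all add: inner_vec2)

lemma norm_rot [simp]: "norm (rot p) = norm p"
  by (simp add: norm_eq_sqrt_inner)

text \<open>Writing the determinant as an inner product with the counterclockwise quarter turn makes
  every orientation condition below a sign condition on an inner product.\<close>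

lemma pos_oriented_eq: "pos_oriented X Y \<longleftrightarrow> Y \<bullet> rot X > 0"
  by (simp add: pos_oriented_def det_2 inner_vec2 mult.commute)

lemma rot_rot [simp]: "rot (rot p) = - p"
  by (simp add: vec_eq_iff forall_2)

text \<open>In the plane the orthogonal complement of a nonzero \<open>p\<close> is the line through
  \<open>rot p\<close>; the coefficient is the usual projection, since \<open>rot p\<close> has
  squared length \<open>r\<^sup>2\<close>.\<close>

lemma orthogonal_imp_rot:
  assumes "v \<bullet> p = 0" "norm p = r" "r > 0"
  shows "v = ((v \<bullet> rot p) / r\<^sup>2) *\<^sub>R rot p"
proof -
  have r: "r\<^sup>2 = p $ 1 * p $ 1 + p $ 2 * p $ 2"
    using assms(2) by (metis inner_vec2 power2_norm_eq_inner)
  have "r\<^sup>2 *\<^sub>R v = (v \<bullet> rot p) *\<^sub>R rot p"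
    using assms(1) unfolding vec_eq_iff forall_2 r by (simp add: inner_vec2) algebra
  then have "(1 / r\<^sup>2) *\<^sub>R (r\<^sup>2 *\<^sub>R v) = (1 / r\<^sup>2) *\<^sub>R ((v \<bullet> rot p) *\<^sub>R rot p)"
    by simp
  then show ?thesis using assms(3) by simp
qed

subsection \<open>Geometry of a circle\<close>

text \<open>Differentiating the constant squared norm of a curve on the circle gives orthogonality
  to \<open>p\<close>. Conversely, every orthogonal vector is the velocity of a uniform
  rotation.\<close>

lemma tangent_space_circle:
  assumes "norm p = r" "r > 0"
  shows "tangent_space (circle r) p = {v. v \<bullet> p = 0}"
proof (intro equalityI subsetI; clarsimp)
  fix v assume "v \<in> tangent_space (circle r) p"
  then obtain c where c: "c 0 = p" "\<forall>\<^sub>F t in nhds 0. c t \<in> circle r"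
    "(c has_vector_derivative v) (at (0::real))"
    by (auto simp: tangent_space_def)
  have "((\<lambda>t. c t \<bullet> c t) has_derivative (\<lambda>t. c 0 \<bullet> (t *\<^sub>R v) + (t *\<^sub>R v) \<bullet> c 0)) (at 0)"
    using c(3) by (intro derivative_intros) (simp_all add: has_vector_derivative_def)
  moreover have "((\<lambda>t. c t \<bullet> c t) has_derivative (\<lambda>t. 0)) (at 0)"
  proof (rule has_derivative_transform_eventually)
    show "((\<lambda>t::real. r\<^sup>2) has_derivative (\<lambda>t. 0)) (at 0)"
      by simp
    have "\<forall>\<^sub>F t in nhds 0. r\<^sup>2 = c t \<bullet> c t"
      using c(2) by eventually_elim (auto simp: power2_norm_eq_inner)
    then show "\<forall>\<^sub>F t in at 0. r\<^sup>2 = c t \<bullet> c t"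
      by (blast dest: eventually_nhds_conv_at[THEN iffD1])
    show "r\<^sup>2 = c 0 \<bullet> c 0"
      using c(1) assms(1) by (simp add: power2_norm_eq_inner[symmetric])
  qed auto
  ultimately have "(\<lambda>t::real. c 0 \<bullet> (t *\<^sub>R v) + (t *\<^sub>R v) \<bullet> c 0) = (\<lambda>t. 0)"
    by (rule has_derivative_unique)
  from fun_cong[OF this, of 1] show "v \<bullet> p = 0"
    using c(1) by (simp add: inner_commute)
next
  fix v :: "real^2" assume v: "v \<bullet> p = 0"
  \<comment> \<open>\<open>k\<close> is the signed-free angular speed at which a point at distance
    \<open>r\<close> moves with speed \<open>norm v\<close>. For \<open>v = 0\<close> division by
    zero yields 0, so \<open>c\<close> is the constant curve \<open>p\<close>.\<close>
  define k where "k = norm v / r"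
  define c where "c = (\<lambda>s. cos (k * s) *\<^sub>R p + (sin (k * s) / k) *\<^sub>R v)"
  have c0: "c 0 = p"
    by (simp add: c_def)
  have on: "c t \<in> circle r" for t
  proof (cases "k = 0")
    case True
    then show ?thesis using assms by (simp add: c_def)
  next
    case False
    then have nv: "v \<bullet> v = k\<^sup>2 * r\<^sup>2"
      using assms by (simp add: k_def power2_norm_eq_inner[symmetric] power_divide)
    have "(norm (c t))\<^sup>2 = (cos (k * t))\<^sup>2 * (p \<bullet> p) + (sin (k * t) / k)\<^sup>2 * (v \<bullet> v)"
      using v unfolding power2_norm_eq_inner c_def
      by (simp add: inner_add_left inner_add_right inner_commute power2_eq_square)
    also have "\<dots> = ((cos (k * t))\<^sup>2 + (sin (k * t))\<^sup>2) * r\<^sup>2"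
      using False assms(1) unfolding nv
      by (simp add: power2_norm_eq_inner[symmetric] power_divide distrib_right
          del: sin_cos_squared_add sin_cos_squared_add2)
    finally have "(norm (c t))\<^sup>2 = r\<^sup>2"
      by (simp only: sin_cos_squared_add2 mult_1)
    then show ?thesis using assms(2) by simp
  qed
  have "(c has_vector_derivative v) (at 0)"
  proof (cases "k = 0")
    case True
    then have "v = 0" using assms by (simp add: k_def)
    then show ?thesis using True by (simp add: c_def)
  next
    case False
    then show ?thesis
      unfolding c_def by (auto intro!: derivative_eq_intros)
  qed
  then show "v \<in> tangent_space (circle r) p"
    unfolding tangent_space_def using c0 on by (intro CollectI exI[of _ c]) auto
qed

lemma pos_tangent_circle:
  assumes "norm p = r" "r > 0"
  shows "pos_tangent (circle r) p X \<longleftrightarrow> X \<bullet> p = 0 \<and> X \<bullet> rot p > 0"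
  using assms by (simp add: pos_tangent_def tangent_space_circle pos_oriented_eq)

lemma length_form_circle:
  assumes "norm p = 1"
  shows "length_form (circle 1) p X = X \<bullet> rot p"
proof -
  have "(THE \<tau>. pos_tangent (circle 1) p \<tau> \<and> norm \<tau> = 1) = rot p"
  proof (rule the_equality)
    show "pos_tangent (circle 1) p (rot p) \<and> norm (rot p) = 1"
      using assms by (simp add: pos_tangent_circle power2_norm_eq_inner[symmetric] flip: norm_eq_1)
    fix \<tau> assume *: "pos_tangent (circle 1) p \<tau> \<and> norm \<tau> = 1"
    then have t: "\<tau> = (\<tau> \<bullet> rot p) *\<^sub>R rot p" "\<tau> \<bullet> rot p > 0"
      using orthogonal_imp_rot[of \<tau> p 1] assms by (simp_all add: pos_tangent_circle)
    then have "norm \<tau> = \<tau> \<bullet> rot p"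
      using assms by (metis abs_of_pos mult.right_neutral norm_rot norm_scaleR)
    with t * show "\<tau> = rot p" by simp
  qed
  then show ?thesis by (simp add: length_form_def)
qed

text \<open>For a counterclockwise tangent \<open>X\<close>, the normal completing \<open>X\<close>
  to a positive basis points inward. This is the origin of the minus sign in the second fundamental
  form.\<close>

lemma unit_normal_circle:
  assumes "norm p = r" "r > 0"
  shows "unit_normal (circle r) p = - (1 / r) *\<^sub>R p"
  unfolding unit_normal_def
proof (rule the_equality)
  have pp: "p \<bullet> p = r\<^sup>2"
    using assms by (simp add: power2_norm_eq_inner[symmetric])
  have "pos_oriented X (- (1 / r) *\<^sub>R p)" if "pos_tangent (circle r) p X" for X
  proof -
    \<comment> \<open>\<open>rot\<close> is skew-adjoint, so moving it from \<open>X\<close> to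
      \<open>p\<close> cancels the sign.\<close>
    have "(- (1 / r) *\<^sub>R p) \<bullet> rot X = (X \<bullet> rot p) / r"
      by (simp add: inner_vec2 diff_divide_distrib add_divide_distrib algebra_simps)
    then show ?thesis
      using that assms by (simp add: pos_oriented_eq pos_tangent_circle)
  qed
  then show "norm (- (1 / r) *\<^sub>R p) = 1 \<and>
      (\<forall>X\<in>tangent_space (circle r) p. X \<bullet> (- (1 / r) *\<^sub>R p) = 0) \<and>
      (\<forall>X. pos_tangent (circle r) p X \<longrightarrow> pos_oriented X (- (1 / r) *\<^sub>R p))"
    using assms by (auto simp: tangent_space_circle)
  fix n assume n: "norm n = 1 \<and> (\<forall>X\<in>tangent_space (circle r) p. X \<bullet> n = 0) \<and>
            (\<forall>X. pos_tangent (circle r) p X \<longrightarrow> pos_oriented X n)"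
  have "rot p \<in> tangent_space (circle r) p" "pos_tangent (circle r) p (rot p)"
    using assms pp by (simp_all add: tangent_space_circle pos_tangent_circle)
  with n have n1: "n \<bullet> rot p = 0" and n2: "n \<bullet> p < 0"
    by (auto simp: pos_oriented_eq inner_commute)
  have n3: "n = ((n \<bullet> p) / r\<^sup>2) *\<^sub>R p"
    using orthogonal_imp_rot[OF n1, of r] assms by simp
  have "norm n = \<bar>(n \<bullet> p) / r\<^sup>2\<bar> * norm p"
    by (subst n3) simp
  then have "(n \<bullet> p) / r\<^sup>2 = - (1 / r)"
    using n n2 assms by (simp add: field_simps power2_eq_square)
  with n3 show "n = - (1 / r) *\<^sub>R p" by simp
qed

text \<open>The tangent line has just two orthonormal bases, consisting of \<open>rot p\<close> or
  of its negative. The choice operator may pick either one; hypothesis \<open>B\<close> makes both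
  give the same value.\<close>

lemma tensor_norm_circle:
  assumes p: "norm p = 1"
    and B: "B (- rot p) (- rot p) = B (rot p) (rot p)"
  shows "(tensor_norm (circle 1) p B)\<^sup>2 = (B (rot p) (rot p))\<^sup>2"
proof -
  let ?T = "tangent_space (circle 1) p"
  have T: "?T = span {rot p}"
  proof -
    have "v \<in> span {rot p}" if "v \<bullet> p = 0" for v
      using orthogonal_imp_rot[OF that p] by (metis span_base span_scale singletonI zero_less_one)
    moreover have "v \<bullet> p = 0" if "v \<in> span {rot p}" for v
      using that by (auto simp: span_singleton)
    ultimately show ?thesis
      using p by (auto simp: tangent_space_circle)
  qed
  define E where "E = (SOME E. orthonormal_basis ?T E)"
  have "orthonormal_basis ?T {rot p}"
    using p T by (simp add: orthonormal_basis_def)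
  then have E: "orthonormal_basis ?T E"
    unfolding E_def by (rule someI)
  have sub: "e = rot p \<or> e = - rot p" if "e \<in> E" for e
  proof -
    have "e \<in> span {rot p}" "norm e = 1"
      using E that T by (auto simp: orthonormal_basis_def intro: span_base)
    then obtain k where k: "e = k *\<^sub>R rot p"
      by (auto simp: span_singleton)
    with \<open>norm e = 1\<close> p have "\<bar>k\<bar> = 1" by simp
    with k show ?thesis by (auto simp: abs_if split: if_splits)
  qed
  have "E \<noteq> {}"
  proof
    assume "E = {}"
    then have "span {rot p} = {0}"
      using E T by (simp add: orthonormal_basis_def)
    then show False
      using p by (metis norm_rot norm_zero singletonD singletonI span_base zero_neq_one)
  qed
  then obtain e where e: "e \<in> E" by blast
  \<comment> \<open>Two members of \<open>E\<close> are equal or opposite unit vectors, so their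
    inner product is 1 or -1, and they cannot be orthogonal.\<close>
  have "f = e" if f: "f \<in> E" for f
  proof (rule ccontr)
    assume "f \<noteq> e"
    then have "f \<bullet> e = 0"
      using E e f by (auto simp: orthonormal_basis_def pairwise_def orthogonal_def)
    then show False
      using sub[OF e] sub[OF f] p by (auto simp: norm_eq_1)
  qed
  with e have "E = {e}" by blast
  then have "tensor_norm (circle 1) p B = \<bar>B e e\<bar>"
    unfolding tensor_norm_def Let_def E_def[symmetric] by simp
  then show ?thesis
    using sub[OF e] B by auto
qed

subsection \<open>Differentials along curves\<close>

text \<open>A derivative within \<open>S\<close> need not be unique as a linear map on the plane,
  but the chain rule fixes its value on the velocity of any curve in \<open>S\<close>. All
  differentials below are computed through such curves.\<close>

lemma differential_curve:
  assumes f: "f differentiable (at (c a) within S)" and c: "\<And>t. c t \<in> S"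
    and v: "(c has_vector_derivative v) (at a)"
  shows "((\<lambda>t. f (c t)) has_vector_derivative differential S f (c a) v) (at a)"
proof -
  let ?D = "frechet_derivative f (at (c a) within S)"
  have D: "(f has_derivative ?D) (at (c a) within S)"
    using f frechet_derivative_works by blast
  then have "(f has_derivative ?D) (at (c a) within range c)"
    by (rule has_derivative_subset) (use c in auto)
  with v have "((\<lambda>t. f (c t)) has_derivative (\<lambda>t. ?D (t *\<^sub>R v))) (at a)"
    unfolding has_vector_derivative_def by (rule has_derivative_in_compose)
  then show ?thesis
    unfolding has_vector_derivative_def differential_def
    using has_derivative_linear[OF D] by (simp add: linear_cmul)
qed

lemma differential_minus:
  assumes "f differentiable (at p within S)"
  shows "differential S f p (- X) = - differential S f p X"
proof -
  have "linear (frechet_derivative f (at p within S))"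
    using assms frechet_derivative_works has_derivative_linear by blast
  then show ?thesis
    by (simp add: differential_def linear_neg)
qed

lemma circle_param_eq:
  "circle_param r t = (r * cos t) *\<^sub>R axis 1 1 + (r * sin t) *\<^sub>R axis 2 1"
  by (simp add: circle_param_def vec_eq_iff forall_2 axis_def)

lemma circle_param_has_vector_derivative:
  "(circle_param r has_vector_derivative rot (circle_param r t)) (at t)"
proof -
  have "rot (circle_param r t) = (- (r * sin t)) *\<^sub>R axis 1 1 + (r * cos t) *\<^sub>R axis 2 1"
    by (simp add: circle_param_def vec_eq_iff forall_2 axis_def)
  then show ?thesis
    unfolding circle_param_eq[abs_def]
    by (auto intro!: derivative_eq_intros simp: mult.commute)
qed

lemma norm_circle_param [simp]: "norm (circle_param 1 t) = 1"
  by (simp add: norm_eq_1 circle_param_def inner_vec2 power2_eq_square[symmetric])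

lemma continuous_on_circle_param: "continuous_on A (circle_param r)"
  using circle_param_has_vector_derivative has_vector_derivative_continuous
  by (metis continuous_at_imp_continuous_on)

lemma continuous_rot: "continuous (at p) rot"
proof -
  have "linear rot"
    by (rule linearI) (simp_all add: vec_eq_iff forall_2)
  then show ?thesis by (simp add: linear_continuous_at linear_conv_bounded_linear)
qed

section \<open>Second fundamental form of a circle\<close>

lemma second_form_circle:
  assumes c: "\<And>t. c t \<in> circle r" and "r > 0" and v: "(c has_vector_derivative v) (at a)"
  shows "second_form (circle r) (c a) v v = - ((norm v)\<^sup>2 / r)"
proof -
  let ?N = "unit_normal (circle r)"
  have N: "?N q = - (1 / r) *\<^sub>R q" if "q \<in> circle r" for q
    using that assms(2) by (intro unit_normal_circle) auto
  \<comment> \<open>The normal field is known only on the circle, where it agrees with a linear map;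
    a derivative within the circle transfers from one to the other.\<close>
  have "((\<lambda>q. - (1 / r) *\<^sub>R q) has_derivative (\<lambda>q. - (1 / r) *\<^sub>R q)) (at (c a) within circle r)"
    by (auto intro!: derivative_eq_intros)
  then have "(?N has_derivative (\<lambda>q. - (1 / r) *\<^sub>R q)) (at (c a) within circle r)"
    by (rule has_derivative_transform[rotated 2]) (use N c in auto)
  then have "?N differentiable (at (c a) within circle r)"
    by (auto simp: differentiable_def)
  then have "((\<lambda>t. ?N (c t)) has_vector_derivative differential (circle r) ?N (c a) v) (at a)"
    by (rule differential_curve) (use c v in auto)
  moreover have "(\<lambda>t. ?N (c t)) = (\<lambda>t. - (1 / r) *\<^sub>R c t)"
    using N c by auto
  moreover have "((\<lambda>t. - (1 / r) *\<^sub>R c t) has_vector_derivative - (1 / r) *\<^sub>R v) (at a)"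
    using v by (auto intro!: derivative_eq_intros)
  ultimately have "differential (circle r) ?N (c a) v = - (1 / r) *\<^sub>R v"
    by (metis vector_derivative_at)
  then show ?thesis
    by (simp add: second_form_def power2_norm_eq_inner)
qed

subsection \<open>The functional in terms of the speed\<close>

text \<open>At each point both tensors are determined by their value on the unit tangent
  \<open>rot (circle_param 1 t)\<close>. Its image under the differential of \<open>h\<close> is the
  velocity \<open>u t\<close>, and the length form takes the value 1 on it.\<close>

lemma Lam_eq:
  assumes "r > 0" and h: "\<And>p. p \<in> circle 1 \<Longrightarrow> h p \<in> circle r"
    and diff: "\<And>p. p \<in> circle 1 \<Longrightarrow> h differentiable (at p within circle 1)"
    and u: "\<And>t. ((\<lambda>t. h (circle_param 1 t)) has_vector_derivative u t) (at t)"
  shows "Lam r h = integral {0..2*pi} (\<lambda>t. ((norm (u t))\<^sup>2 - 1)\<^sup>2)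
      + integral {0..2*pi} (\<lambda>t. ((norm (u t))\<^sup>2 / r - 1)\<^sup>2)"
proof -
  let ?c = "circle_param 1"
  have c: "?c t \<in> circle 1" for t
    by simp
  have cv: "vector_derivative ?c (at t) = rot (?c t)" for t
    by (rule vector_derivative_at) (rule circle_param_has_vector_derivative)
  have du: "differential (circle 1) h (?c t) (rot (?c t)) = u t" for t
    using differential_curve[OF diff[OF c] c circle_param_has_vector_derivative] u
    by (metis vector_derivative_at)
  have du': "differential (circle 1) h (?c t) (- rot (?c t)) = - u t" for t
    using du differential_minus[OF diff[OF c]] by simp
  have len: "length_form (circle 1) (?c t) (rot (?c t)) = 1" for t
    by (simp add: length_form_circle flip: power2_norm_eq_inner)
  \<comment> \<open>Evenness in \<open>v\<close> supplies the hypothesis of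
    \<open>tensor_norm_circle\<close>. It follows by running the curve backwards through the same
    point.\<close>
  have II_neg: "second_form (circle s) (d a) (- v) (- v) = second_form (circle s) (d a) v v"
    if "\<And>t. d t \<in> circle s" "s > 0" "(d has_vector_derivative v) (at a)" for d s a v
  proof -
    have rev: "((\<lambda>t. d (2 * a - t)) has_vector_derivative - v) (at a)"
    proof -
      have "((d \<circ> (\<lambda>t. 2 * a - t)) has_vector_derivative (-1) *\<^sub>R v) (at a)"
        by (rule vector_diff_chain_at) (use that in \<open>auto intro!: derivative_eq_intros\<close>)
      then show ?thesis by (simp add: o_def)
    qed
    show ?thesis
      using second_form_circle[OF _ that(2) rev] second_form_circle[OF that] that(1) by simp
  qed
  have IIN: "second_form (circle r) (h (?c t)) (u t) (u t) = - ((norm (u t))\<^sup>2 / r)" for t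
    using second_form_circle[of "\<lambda>t. h (?c t)", OF h[OF c] assms(1) u] by simp
  have IIN': "second_form (circle r) (h (?c t)) (- u t) (- u t) = - ((norm (u t))\<^sup>2 / r)" for t
    using II_neg[of "\<lambda>t. h (?c t)", OF h[OF c] assms(1) u] IIN by simp
  have IIM: "second_form (circle 1) (?c t) (rot (?c t)) (rot (?c t)) = - 1" for t
    using second_form_circle[OF c _ circle_param_has_vector_derivative, of t] by simp
  have IIM': "second_form (circle 1) (?c t) (- rot (?c t)) (- rot (?c t)) = - 1" for t
    using II_neg[of ?c 1, OF c _ circle_param_has_vector_derivative, of t] IIM by simp
  have "(tensor_norm (circle 1) (?c t)
      (\<lambda>Y Z. pullback (circle 1) h induced_metric (?c t) Y Z - induced_metric (?c t) Y Z))\<^sup>2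
      = ((norm (u t))\<^sup>2 - 1)\<^sup>2" for t
    by (subst tensor_norm_circle)
      (simp_all add: pullback_def induced_metric_def du du' flip: power2_norm_eq_inner)
  moreover have "(tensor_norm (circle 1) (?c t)
      (\<lambda>Y Z. pullback (circle 1) h (second_form (circle r)) (?c t) Y Z
        - second_form (circle 1) (?c t) Y Z))\<^sup>2
      = ((norm (u t))\<^sup>2 / r - 1)\<^sup>2" for t
    by (subst tensor_norm_circle)
      (simp_all add: pullback_def du du' IIN IIN' IIM IIM' power2_commute)
  ultimately show ?thesis
    by (simp add: Lam_def Let_def form_integral_def cv len)
qed

subsection \<open>The length of the image curve\<close>

text \<open>Smoothness is given only by local extensions to open sets of the plane. Each one yields
  the derivative of \<open>h\<close> within the circle and, near the corresponding parameter, a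
  continuous formula for the velocity.\<close>

lemma C2_map_circle_curve:
  assumes "C2_map (circle 1) h"
  obtains u where "\<And>p. p \<in> circle 1 \<Longrightarrow> h differentiable (at p within circle 1)"
    and "\<And>t. ((\<lambda>t. h (circle_param 1 t)) has_vector_derivative u t) (at t)"
    and "continuous_on UNIV u"
proof -
  let ?c = "circle_param 1"
  have c: "?c t \<in> circle 1" for t
    by simp
  \<comment> \<open>From the class C2 data only continuity of the first derivative at
    \<open>p\<close> is kept; it holds because that derivative is itself differentiable
    there.\<close>
  have loc: "\<exists>U F F'. open U \<and> p \<in> U \<and> (\<forall>q\<in>U \<inter> circle 1. F q = h q) \<and>
      (\<forall>x\<in>U. (F has_derivative blinfun_apply (F' x)) (at x)) \<and> isCont F' p"
    if "p \<in> circle 1" for p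
    using assms that unfolding C2_map_def C2_on_def
    by (meson has_derivative_continuous)
  define u where "u = (\<lambda>t. vector_derivative (\<lambda>t. h (?c t)) (at t))"
  have diff: "h differentiable (at p within circle 1)" if p: "p \<in> circle 1" for p
  proof -
    obtain U F F' where U: "open U" "p \<in> U" "\<forall>q\<in>U \<inter> circle 1. F q = h q"
      "\<forall>x\<in>U. (F has_derivative blinfun_apply (F' x)) (at x)"
      using loc[OF p] by blast
    obtain d where d: "d > 0" "ball p d \<subseteq> U"
      using U(1,2) open_contains_ball by blast
    have "(h has_derivative blinfun_apply (F' p)) (at p within circle 1)"
    proof (rule has_derivative_transform_within[OF _ d(1) p])
      show "(F has_derivative blinfun_apply (F' p)) (at p within circle 1)"
        using U by (blast intro: has_derivative_at_withinI)
      show "F q = h q" if "q \<in> circle 1" "dist q p < d" for q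
        using that d(2) U(3) by (auto simp: subset_iff dist_commute)
    qed
    then show ?thesis by (auto simp: differentiable_def)
  qed
  have u: "((\<lambda>t. h (?c t)) has_vector_derivative u t) (at t)" for t
    using differential_curve[OF diff[OF c] c circle_param_has_vector_derivative]
    unfolding u_def by (metis vector_derivative_at)
  have "isCont u t0" for t0
  proof -
    obtain U F F' where U: "open U" "?c t0 \<in> U" "\<forall>q\<in>U \<inter> circle 1. F q = h q"
      "\<forall>x\<in>U. (F has_derivative blinfun_apply (F' x)) (at x)" "isCont F' (?c t0)"
      using loc[OF c[of t0]] by blast
    define V where "V = ?c -` U"
    have V: "open V" "t0 \<in> V"
      unfolding V_def using U(1,2) continuous_on_circle_param by (auto intro: open_vimage)
    \<comment> \<open>On \<open>V\<close> the curves through \<open>h\<close> and through its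
      extension \<open>F\<close> coincide, so the velocity is the derivative of \<open>F\<close>
      applied to the tangent.\<close>
    have eq: "u t = blinfun_apply (F' (?c t)) (rot (?c t))" if "t \<in> V" for t
    proof -
      have "(F has_derivative blinfun_apply (F' (?c t))) (at (?c t))"
        using U(4) that by (simp add: V_def)
      then have "((F \<circ> ?c) has_vector_derivative blinfun_apply (F' (?c t)) (rot (?c t))) (at t)"
        using vector_derivative_diff_chain_within
          [OF circle_param_has_vector_derivative has_derivative_at_withinI] by blast
      then have "((\<lambda>t. h (?c t)) has_vector_derivative blinfun_apply (F' (?c t)) (rot (?c t))) (at t)"
        by (rule has_vector_derivative_transform_within_open[OF _ V(1) that])
          (use U(3) c in \<open>auto simp: V_def\<close>)
      then show ?thesis using u vector_derivative_at by metis
    qed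
    have "isCont (\<lambda>t. blinfun_apply (F' (?c t)) (rot (?c t))) t0"
    proof -
      have c0: "isCont ?c t0"
        using circle_param_has_vector_derivative has_vector_derivative_continuous by blast
      show ?thesis
        by (intro blinfun.isCont isCont_o2[OF c0] U(5)) (rule continuous_rot)
    qed
    moreover have "\<forall>\<^sub>F t in nhds t0. u t = blinfun_apply (F' (?c t)) (rot (?c t))"
      using V eq eventually_nhds by blast
    ultimately show ?thesis
      using isCont_cong by fast
  qed
  then show thesis
    using that[OF diff u] by (simp add: continuous_at_imp_continuous_on)
qed

text \<open>The contour integral of \<open>1 / w\<close> has modulus \<open>2 * pi\<close>, because
  the path winds once around 0 in one direction or the other. As \<open>cmod (g s) = r\<close>, that
  modulus is at most the length divided by \<open>r\<close>.\<close>

lemma length_simple_closed_path_circle: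
  fixes g :: "real \<Rightarrow> complex"
  assumes "valid_path g" "simple_path g"
    and img: "path_image g = sphere 0 r" and "r > 0"
    and v: "\<And>s. s \<in> {0..1} \<Longrightarrow> (g has_vector_derivative v s) (at s)" "continuous_on {0..1} v"
  shows "2 * pi * r \<le> integral {0..1} (\<lambda>s. norm (v s))"
proof -
  \<comment> \<open>The inside of the frontier of a bounded convex set is its interior, which
    identifies the inside of the path.\<close>
  have "frontier (ball 0 r) = path_image g"
    using img \<open>r > 0\<close> by simp
  then have "inside (path_image g) = ball (0::complex) r"
    by (metis bounded_ball convex_ball inside_frontier_eq_interior interior_ball)
  then have in0: "0 \<in> inside (path_image g)"
    using \<open>r > 0\<close> by simp
  have not0: "0 \<notin> path_image g"
    using img \<open>r > 0\<close> by simp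
  \<comment> \<open>Only the modulus is taken, so orientation-reversing diffeomorphisms are covered
    as well.\<close>
  have "cmod (winding_number g 0) = 1"
    using assms(2) in0 by (rule simple_closed_path_norm_winding_number_inside)
  moreover have wn: "winding_number g 0 = 1 / (2 * pi * \<i>) * contour_integral g (\<lambda>w. 1 / (w - 0))"
    using assms(1) not0 by (rule winding_number_valid_path)
  ultimately have "2 * pi = cmod (contour_integral g (\<lambda>w. 1 / w))"
    by (simp add: norm_mult norm_divide field_simps)
  also have "\<dots> = cmod (integral {0..1} (\<lambda>s. 1 / g s * v s))"
    unfolding contour_integral_integral
    by (intro arg_cong[where f = cmod] integral_cong) (use v(1) vector_derivative_at in fastforce)
  also have "\<dots> \<le> integral {0..1} (\<lambda>s. norm (v s) / r)"
  proof (rule integral_norm_bound_integral)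
    have g: "continuous_on {0..1} g"
      using assms(1) valid_path_imp_path path_def by blast
    have gr: "cmod (g s) = r" if "s \<in> {0..1}" for s
      using img that by (auto simp: path_image_def)
    show "(\<lambda>s. 1 / g s * v s) integrable_on {0..1}"
      using gr \<open>r > 0\<close> by (intro integrable_continuous_real continuous_intros g v(2)) fastforce
    show "(\<lambda>s. norm (v s) / r) integrable_on {0..1}"
      using \<open>r > 0\<close> by (intro integrable_continuous_real continuous_intros v(2)) auto
    show "cmod (1 / g s * v s) \<le> norm (v s) / r" if "s \<in> {0..1}" for s
      using gr[OF that] by (simp add: norm_mult norm_divide)
  qed
  also have "\<dots> = integral {0..1} (\<lambda>s. norm (v s)) / r"
    by simp
  finally show ?thesis
    using \<open>r > 0\<close> by (simp add: field_simps)
qed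

text \<open>The isometry \<open>C\<close> carries the image curve into the complex plane, where the
  winding number bound applies. Injectivity of \<open>h\<close> makes the curve simple, and
  surjectivity makes it cover the whole target circle.\<close>

lemma length_image_circle:
  assumes "r > 0" and bij: "bij_betw h (circle 1) (circle r)"
    and u: "\<And>t. ((\<lambda>t. h (circle_param 1 t)) has_vector_derivative u t) (at t)"
    and cu: "continuous_on UNIV u"
  shows "2 * pi * r \<le> integral {0..2*pi} (\<lambda>t. norm (u t))"
proof -
  define C :: "real^2 \<Rightarrow> complex" where "C = (\<lambda>x. Complex (x $ 1) (x $ 2))"
  have normC [simp]: "cmod (C x) = norm x" for x
    by (simp add: C_def cmod_def norm_eq_sqrt_inner inner_vec2 power2_eq_square)
  have linC: "bounded_linear C"
    by (rule bounded_linear_intro[of _ 1])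
      (simp_all add: C_def complex_eq_iff cmod_def norm_eq_sqrt_inner inner_vec2 power2_eq_square)
  have injC: "inj C"
    by (auto simp: inj_def C_def vec_eq_iff forall_2)
  have imgC: "C ` circle r = sphere 0 r" for r
  proof -
    have "z \<in> C ` circle r" if "cmod z = r" for z
    proof (rule image_eqI)
      show z: "z = C (vector [Re z, Im z])"
        by (simp add: C_def)
      show "vector [Re z, Im z] \<in> circle r"
        using that normC z by (metis mem_sphere_0)
    qed
    then show ?thesis by auto
  qed
  define g where "g = (\<lambda>s. C (h (circle_param 1 (2 * pi * s))))"
  \<comment> \<open>Identifying the parametrization with \<open>circlepath\<close> lets
    \<open>g\<close> inherit loop-freeness and its path image from the standard circle.\<close>
  have circ: "circlepath 0 1 s = C (circle_param 1 (2 * pi * s))" for s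
    by (simp add: circlepath C_def circle_param_def complex_eq_iff Re_exp Im_exp)
  \<comment> \<open>The factor \<open>2 * pi\<close> comes from rescaling the parameter to the unit
    interval; the final substitution removes it.\<close>
  define v where "v = (\<lambda>s. (2 * pi) *\<^sub>R C (u (2 * pi * s)))"
  have gv: "(g has_vector_derivative v s) (at s)" for s
  proof -
    have "(((\<lambda>t. h (circle_param 1 t)) \<circ> (\<lambda>s. 2 * pi * s)) has_vector_derivative
        (2 * pi) *\<^sub>R u (2 * pi * s)) (at s)"
      by (rule vector_diff_chain_at) (auto intro!: derivative_eq_intros u)
    from bounded_linear.has_vector_derivative[OF linC this] show ?thesis
      by (simp add: g_def v_def o_def linear_cmul[OF bounded_linear.linear[OF linC]])
  qed
  have vc: "continuous_on A v" for A
    unfolding v_def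
    by (intro continuous_intros bounded_linear.continuous_on[OF linC]
        continuous_on_compose2[OF cu]) auto
  have "g C1_differentiable_on {0..1}"
    unfolding C1_differentiable_on_def using gv vc by blast
  then have valid: "valid_path g"
    by (simp add: valid_path_def C1_differentiable_imp_piecewise)
  have g_eq: "g = (\<lambda>s. C (h (inv C (circlepath 0 1 s))))"
    by (simp add: g_def circ inv_f_f[OF injC])
  have hinj: "inj_on h (circle 1)" and himg: "h ` circle 1 = circle r"
    using bij by (auto simp: bij_betw_def)
  have loop: "loop_free g"
    unfolding loop_free_def
  proof (intro ballI impI)
    fix s t :: real assume st: "s \<in> {0..1}" "t \<in> {0..1}" and "g s = g t"
    then have "h (circle_param 1 (2 * pi * s)) = h (circle_param 1 (2 * pi * t))"
      using injC by (simp add: g_def inj_def)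
    then have "circle_param 1 (2 * pi * s) = circle_param 1 (2 * pi * t)"
      using hinj by (simp add: inj_on_def)
    then have "circlepath 0 1 s = circlepath 0 1 t"
      by (simp add: circ)
    moreover have "loop_free (circlepath 0 1)"
      using simple_path_circlepath[of 0 1] by (simp add: simple_path_def)
    ultimately show "s = t \<or> s = 0 \<and> t = 1 \<or> s = 1 \<and> t = 0"
      using st by (auto simp: loop_free_def)
  qed
  with valid have simple: "simple_path g"
    by (simp add: simple_path_def valid_path_imp_path)
  have "path_image g = C ` h ` inv C ` path_image (circlepath 0 1)"
    by (simp add: path_image_def g_eq image_image)
  also have "inv C ` path_image (circlepath 0 1) = circle 1"
    by (simp add: imgC[symmetric] image_image inv_f_f[OF injC])
  finally have img: "path_image g = sphere 0 r"
    by (simp add: himg imgC)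
  have "2 * pi * r \<le> integral {0..1} (\<lambda>s. norm (v s))"
    using valid simple img assms(1) gv vc by (rule length_simple_closed_path_circle)
  also have "\<dots> = integral {0..2*pi} (\<lambda>t. norm (u t))"
  proof -
    have "((\<lambda>s. (2 * pi) *\<^sub>R norm (u (2 * pi * s))) has_integral
        integral {2 * pi * 0..2 * pi * 1} (\<lambda>t. norm (u t))) {0..1}"
      by (rule has_integral_substitution[where c = 0 and d = "2 * pi"])
        (auto intro!: derivative_eq_intros continuous_on_norm continuous_on_subset[OF cu])
    then show ?thesis
      by (intro integral_unique) (simp add: v_def)
  qed
  finally show ?thesis .
qed

subsection \<open>Minimality\<close>

text \<open>The quartic is not convex near 0, so convexity does not give the bound. Instead the
  double root of the difference at \<open>u = R\<close> is factored out, and the remaining quadratic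
  is bounded below for nonnegative \<open>u\<close>.\<close>

lemma quartic_tangent_line:
  fixes R u :: real
  assumes "R > 1" "u \<ge> 0"
  shows "(R\<^sup>2 - 1)\<^sup>2 + (R - 1)\<^sup>2 + 4 * (R^3 - 1) * (u - R) \<le> (u\<^sup>2 - 1)\<^sup>2 + (u\<^sup>2 / R - 1)\<^sup>2"
proof -
  have "(u\<^sup>2 - 1)\<^sup>2 + (u\<^sup>2 / R - 1)\<^sup>2 - ((R\<^sup>2 - 1)\<^sup>2 + (R - 1)\<^sup>2 + 4 * (R^3 - 1) * (u - R))
      = (u - R)\<^sup>2 * ((1 + 1 / R\<^sup>2) * (u\<^sup>2 + 2 * R * u + 3 * R\<^sup>2) - (2 + 2 / R))"
    using assms(1) by (simp add: field_simps) algebra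
  moreover have "(1 + 1 / R\<^sup>2) * (u\<^sup>2 + 2 * R * u + 3 * R\<^sup>2) \<ge> 2 + 2 / R"
  proof -
    \<comment> \<open>These give \<open>2 + 2 / R\<close> at most 4, while
      \<open>3 * R\<^sup>2 + 3\<close> exceeds 6. The latter is the value of the positive part of
      the cofactor at \<open>u = 0\<close>, where it is smallest.\<close>
    have "2 / R \<le> 2" "1 < R\<^sup>2"
      using assms(1) by (simp_all add: field_simps one_less_power)
    then have "2 + 2 / R \<le> 3 * R\<^sup>2 + 3"
      by linarith
    also have "\<dots> = (1 + 1 / R\<^sup>2) * (3 * R\<^sup>2)"
      using assms(1) by (simp add: distrib_right)
    also have "\<dots> \<le> (1 + 1 / R\<^sup>2) * (u\<^sup>2 + 2 * R * u + 3 * R\<^sup>2)"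
      using assms by (intro mult_left_mono) auto
    finally show ?thesis .
  qed
  ultimately show ?thesis
    by (smt (verit) mult_nonneg_nonneg zero_le_power2)
qed

section \<open>The radial map and its value\<close>

lemma C2_on_scaleR: "C2_on U (\<lambda>p. a *\<^sub>R p)"
  unfolding C2_on_def
proof (intro exI conjI ballI)
  fix x :: "real^2"
  show "((\<lambda>p. a *\<^sub>R p) has_derivative blinfun_apply (a *\<^sub>R id_blinfun)) (at x)"
    by (auto intro!: derivative_eq_intros simp: blinfun.scaleR_left)
  show "((\<lambda>_. a *\<^sub>R id_blinfun) has_derivative blinfun_apply 0) (at x)"
    by (simp add: zero_blinfun.rep_eq)
qed auto

lemma C2_map_scaleR:
  assumes "\<And>p. p \<in> S \<Longrightarrow> f p = a *\<^sub>R p"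
  shows "C2_map S f"
  unfolding C2_map_def using assms C2_on_scaleR[of UNIV a]
  by (intro ballI exI[of _ UNIV] exI[of _ "\<lambda>p. a *\<^sub>R p"]) auto

lemma scaleR_in_Diff2:
  assumes "R > 0"
  shows "restrict (\<lambda>p. R *\<^sub>R p) (circle 1) \<in> Diff2 (circle 1) (circle R)"
proof -
  let ?h = "restrict (\<lambda>p::real^2. R *\<^sub>R p) (circle 1)"
  have bij: "bij_betw ?h (circle 1) (circle R)"
    by (rule bij_betw_byWitness[where f' = "\<lambda>q. (1 / R) *\<^sub>R q"]) (use assms in auto)
  have "inv_into (circle 1) ?h q = (1 / R) *\<^sub>R q" if "q \<in> circle R" for q
    by (rule inv_into_f_eq) (use that bij assms in \<open>auto simp: bij_betw_def\<close>)
  then have "C2_map (circle R) (inv_into (circle 1) ?h)"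
    by (rule C2_map_scaleR)
  moreover have "C2_map (circle 1) ?h"
    by (rule C2_map_scaleR[where a = R]) simp
  ultimately show ?thesis
    using bij assms by (auto simp: Diff2_def)
qed

text \<open>The radial map has constant speed \<open>R\<close>, the point of tangency in
  \<open>quartic_tangent_line\<close>, so it attains the lower bound exactly.\<close>

lemma Lam_scaleR:
  assumes "R > 0"
  shows "Lam R (restrict (\<lambda>p. R *\<^sub>R p) (circle 1)) = 2 * pi * ((R\<^sup>2 - 1)\<^sup>2 + (R - 1)\<^sup>2)"
proof -
  let ?h = "restrict (\<lambda>p::real^2. R *\<^sub>R p) (circle 1)"
  have diff: "?h differentiable (at p within circle 1)" if "p \<in> circle 1" for p
  proof -
    have "((\<lambda>p. R *\<^sub>R p) has_derivative (\<lambda>p. R *\<^sub>R p)) (at p within circle 1)"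
      by (auto intro!: derivative_eq_intros)
    then have "(?h has_derivative (\<lambda>p. R *\<^sub>R p)) (at p within circle 1)"
      by (rule has_derivative_transform[rotated 2]) (use that in auto)
    then show ?thesis by (auto simp: differentiable_def)
  qed
  have der: "((\<lambda>t. ?h (circle_param 1 t)) has_vector_derivative R *\<^sub>R rot (circle_param 1 t)) (at t)"
    for t
    by (auto intro!: derivative_eq_intros circle_param_has_vector_derivative)
  have "Lam R ?h = integral {0..2*pi} (\<lambda>t. (R\<^sup>2 - 1)\<^sup>2) + integral {0..2*pi} (\<lambda>t. (R\<^sup>2 / R - 1)\<^sup>2)"
    using assms by (subst Lam_eq[OF assms _ diff der]) auto
  also have "R\<^sup>2 / R = R"
    using assms by (simp add: power2_eq_square)
  finally show ?thesis
    by (simp only: integral_const_real) (simp add: algebra_simps)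
qed

lemma Lam_Diff2_ge:
  assumes R: "R > 1" and "h \<in> Diff2 (circle 1) (circle R)"
  shows "Lam R h \<ge> 2 * pi * ((R\<^sup>2 - 1)\<^sup>2 + (R - 1)\<^sup>2)"
proof -
  from assms(2) have h: "\<And>p. p \<in> circle 1 \<Longrightarrow> h p \<in> circle R" "bij_betw h (circle 1) (circle R)"
    "C2_map (circle 1) h"
    by (auto simp: Diff2_def)
  from h(3) obtain u where
    diff: "\<And>p. p \<in> circle 1 \<Longrightarrow> h differentiable (at p within circle 1)" and
    u: "\<And>t. ((\<lambda>t. h (circle_param 1 t)) has_vector_derivative u t) (at t)" and
    cu: "continuous_on UNIV u"
    using C2_map_circle_curve by blast
  define w where "w = (\<lambda>t. norm (u t))"
  define A where "A = (R\<^sup>2 - 1)\<^sup>2 + (R - 1)\<^sup>2"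
  have cw: "continuous_on {0..2*pi} w"
    unfolding w_def by (intro continuous_intros continuous_on_subset[OF cu]) auto
  have R3: "R^3 > 1"
    using R by (simp add: one_less_power)
  \<comment> \<open>The added term is nonnegative: the slope is positive by \<open>R3\<close>, and
    the integral of \<open>w\<close> is the length bounded by
    \<open>length_image_circle\<close>.\<close>
  have "2 * pi * A \<le> 2 * pi * A + 4 * (R^3 - 1) * (integral {0..2*pi} w - 2 * pi * R)"
    using length_image_circle[OF _ h(2) u cu] R R3 by (simp add: w_def)
  also have "\<dots> = integral {0..2*pi} (\<lambda>t. A + 4 * (R^3 - 1) * (w t - R))"
  proof -
    have "((\<lambda>t. A + 4 * (R^3 - 1) * (w t - R)) has_integral
        (2 * pi - 0) *\<^sub>R A + 4 * (R^3 - 1) * (integral {0..2*pi} w - (2 * pi - 0) *\<^sub>R R)) {0..2*pi}"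
      using has_integral_const_real[of A 0 "2 * pi"] has_integral_const_real[of R 0 "2 * pi"] cw
      by (intro has_integral_add has_integral_mult_right has_integral_diff integrable_integral
          integrable_continuous_real) simp_all
    then show ?thesis by (simp add: integral_unique)
  qed
  \<comment> \<open>The tangent line inequality is applied pointwise to the speed
    \<open>w t\<close>, which is a norm and hence nonnegative.\<close>
  also have "\<dots> \<le> integral {0..2*pi} (\<lambda>t. ((w t)\<^sup>2 - 1)\<^sup>2 + ((w t)\<^sup>2 / R - 1)\<^sup>2)"
    using R quartic_tangent_line[OF R]
    by (intro integral_le integrable_continuous_real continuous_intros cw)
      (auto simp: A_def w_def)
  also have "\<dots> = Lam R h"
  proof -
    have "Lam R h = integral {0..2*pi} (\<lambda>t. ((w t)\<^sup>2 - 1)\<^sup>2)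
        + integral {0..2*pi} (\<lambda>t. ((w t)\<^sup>2 / R - 1)\<^sup>2)"
      unfolding w_def by (rule Lam_eq[OF _ h(1) diff u]) (use R in auto)
    also have "\<dots> = integral {0..2*pi} (\<lambda>t. ((w t)\<^sup>2 - 1)\<^sup>2 + ((w t)\<^sup>2 / R - 1)\<^sup>2)"
      using R by (intro integral_add[symmetric] integrable_continuous_real continuous_intros cw) auto
    finally show ?thesis by simp
  qed
  finally show ?thesis by (simp add: A_def)
qed

theorem lemma3p1:
  fixes R :: real
  assumes "R > 1"
  shows "is_arg_min (Lam R) (\<lambda>h. h \<in> Diff2 (circle 1) (circle R))
           (restrict (\<lambda>p. R *\<^sub>R p) (circle 1))"
  using assms scaleR_in_Diff2[of R] Lam_scaleR[of R] Lam_Diff2_ge[of R]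
  by (auto simp: is_arg_min_def not_less)

end
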